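(* Let $d\ge 2$. Every $d$-variate quasi-copula can be obtained as a pointwise supremum of a set of pointwise infima of sets of $d$-variate shuffles of min, and it can also be obtained as a pointwise infimum of a set of pointwise suprema of sets of $d$-variate shuffles of min. That is, for every $d$-variate quasi-copula $Q$ there exist indexed families $\{\mathcal{M}_i\}_{i\in I}$ and $\{\widetilde{\mathcal{M}}_j\}_{j\in J}$ of sets of $d$-variate shuffles of min such that for all $\mathbf{u}\in[0,1]^d$ \[ Q(\mathbf{u})=\inf_{i\in I}\,\sup_{C\in\mathcal{M}_i}C(\mathbf{u})\quad\text{and}\quad Q(\mathbf{u})=\sup_{j\in J}\,\inf_{C\in\widetilde{\mathcal{M}}_j}C(\mathbf{u}). \]
   Context: A $d$-variate quasi-copula is a function $A\colon[0,1]^d\to[0,1]$ such that (i) $A(1,\ldots,1,u_j,1,\ldots,1)=u_j$ for every $j\in\{1,\dots,d\}$ and $u_j\in[0,1]$; (ii) $A$ is increasing (non-decreasing) in each variable; (iii) $|A(\mathbf{v})-A(\mathbf{u})|\le\sum_{j=1}^d|v_j-u_j|$ for all $\mathbf{u},\mathbf{v}\in[0,1]^d$. An interval exchange is a map $\phi\colon(0,1]\to(0,1]$ given by a partition of $(0,1]$ into finitely many intervals $J_i=(a_{i-1},a_i]$, $0=a_0\le a_1\le\cdots\le a_N=1$, and a permutation $\pi$ of $\{1,\dots,N\}$, via $\phi(t)=t-a_{i-1}+\sum_{j:\,\pi(j)<\pi(i)}\lambda(J_j)$ for $t\in J_i$, where $\lambda$ is Lebesgue measure (so $J_i$ is translated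 to the $\pi(i)$-th position). A $d$-variate shuffle of min is a copula whose mass is obtained from the mass of the copula $M(\mathbf{u})=\min\{u_1,\dots,u_d\}$ (uniform mass on the main diagonal of the cube) by slicing the cube by finitely many hyperplanes orthogonal to each coordinate axis and permuting the slices by translations, independently for each coordinate; i.e., a function of the form $C(\mathbf{u})=\lambda(\{t\in(0,1]:\phi_k(t)\le u_k\text{ for all }k=1,\dots,d\})$, where $\phi_1,\dots,\phi_d$ are interval exchanges (possibly with different partitions and permutations). All index sets and all sets over which infima and suprema are taken are nonempty. *)

theory Defs
  imports "HOL-Analysis.Analysis" "HOL-Combinatorics.Permutations"
begin

text \<open>
  Functions on \<open>[0,1]\<^sup>d\<close> are represented by total functions on \<open>real ^ 'n\<close>, \<open>d = CARD('n)\<close>, of which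
  only the values on the unit cube are constrained.
\<close>

definition unit_cube :: "(real ^ 'n) set" where
  "unit_cube = {u. \<forall>i. u $ i \<in> {0..1}}"

definition quasi_copula :: "(real ^ 'n::finite \<Rightarrow> real) \<Rightarrow> bool" where
  "quasi_copula A \<longleftrightarrow>
     (\<forall>u\<in>unit_cube. A u \<in> {0..1}) \<and>
     (\<forall>j. \<forall>t\<in>{0..1}. A (\<chi> i. if i = j then t else 1) = t) \<and>
     (\<forall>u\<in>unit_cube. \<forall>j. \<forall>t\<in>{u $ j..1}. A u \<le> A (\<chi> i. if i = j then t else u $ i)) \<and>
     (\<forall>u\<in>unit_cube. \<forall>v\<in>unit_cube. \<bar>A v - A u\<bar> \<le> (\<Sum>j\<in>UNIV. \<bar>v $ j - u $ j\<bar>))"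

text \<open>Only the values of \<open>\<phi>\<close> on \<open>(0,1]\<close> are constrained.\<close>

definition interval_exchange :: "(real \<Rightarrow> real) \<Rightarrow> bool" where
  "interval_exchange \<phi> \<longleftrightarrow>
     (\<exists>(N::nat) (a :: nat \<Rightarrow> real) (\<pi> :: nat \<Rightarrow> nat).
        a 0 = 0 \<and> a N = 1 \<and> (\<forall>i\<in>{1..N}. a (i - 1) \<le> a i) \<and> \<pi> permutes {1..N} \<and>
        (\<forall>i\<in>{1..N}. \<forall>t\<in>{a (i - 1)<..a i}.
           \<phi> t = t - a (i - 1)
             + (\<Sum>j | j \<in> {1..N} \<and> \<pi> j < \<pi> i. measure lborel {a (j - 1)<..a j})))"

definition shuffle_of_min :: "(real ^ 'n::finite \<Rightarrow> real) \<Rightarrow> bool" where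
  "shuffle_of_min C \<longleftrightarrow>
     (\<exists>\<phi> :: 'n \<Rightarrow> real \<Rightarrow> real. (\<forall>k. interval_exchange (\<phi> k)) \<and>
        (\<forall>u\<in>unit_cube. C u = measure lborel {t \<in> {0<..1}. \<forall>k. \<phi> k t \<le> u $ k}))"

end

theory Submission
  imports Defs
begin

text \<open>
  Both representations follow from one interpolation property: for any two points \<open>u\<close>, \<open>v\<close> of the
  cube there is a shuffle of min \<open>C\<close> with \<open>C u \<le> Q u\<close> and \<open>Q v \<le> C v\<close>. Given this, let \<open>S\<^sub>u\<close> be the
  set of all shuffles lying below \<open>Q\<close> at \<open>u\<close>. The supremum of \<open>S\<^sub>u\<close> dominates \<open>Q\<close> everywhere and
  is at most \<open>Q u\<close> at \<open>u\<close>, so the infimum over \<open>u\<close> of these suprema is \<open>Q\<close>. The other formula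
  comes from the same property, applied to the sets of shuffles lying above \<open>Q\<close> at a given point
  (lemma \<open>inf_sup_and_sup_inf_of_two_point_interpolation\<close>).

  The interpolation uses the following about \<open>p = Q u\<close> and \<open>q = Q v\<close>: both are nonnegative,
  \<open>1 - p \<le> (\<Sum>k. 1 - u\<^sub>k)\<close>, \<open>q \<le> v\<^sub>k\<close> for all \<open>k\<close>, and \<open>q - p \<le> (\<Sum>k. max 0 (v\<^sub>k - u\<^sub>k))\<close>. An interval
  exchange can sort \<open>(0,1]\<close> so that two prescribed nested finite unions of intervals become initial
  segments (lemma \<open>interval_exchange_of_chain\<close>). Hence it suffices to find, for each coordinate
  \<open>k\<close>, comparable unions of intervals \<open>A\<^sub>k\<close>, \<open>B\<^sub>k\<close> of lengths \<open>u\<^sub>k\<close>, \<open>v\<^sub>k\<close> such that the intersection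
  of the \<open>A\<^sub>k\<close> has length at most \<open>p\<close> and that of the \<open>B\<^sub>k\<close> has length at least \<open>q\<close>. The second
  requirement is met by letting every \<open>B\<^sub>k\<close> contain \<open>(0,q]\<close>. For the first, the complements of the
  \<open>A\<^sub>k\<close> have to cover all of \<open>(0,1]\<close> up to length \<open>p\<close>. Every piece of these complements is placed
  greedily on what is not yet covered, so that length is wasted only when nothing is left to cover
  (lemma \<open>greedy_cover\<close>): first the parts common to the complements of \<open>A\<^sub>k\<close> and \<open>B\<^sub>k\<close>, which
  must stay inside \<open>(q,1]\<close>, then the parts of \<open>B\<^sub>k - A\<^sub>k\<close>, which may also lie in \<open>(0,q]\<close>
  (lemma \<open>shuffle_of_min_between\<close>).
\<close>

section \<open>Interval exchanges that sort a step function\<close>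

text \<open>
  The half-open window \<open>{s..<t}\<close> makes the steps left-open and right-closed: a jump at \<open>f\<close> separates
  \<open>f\<close> from the points to its right, matching the cells \<open>(a\<^sub>i\<^sub>-\<^sub>1, a\<^sub>i]\<close> of an interval exchange.
\<close>

definition step_on :: "real set \<Rightarrow> (real \<Rightarrow> 'a) \<Rightarrow> bool" where
  "step_on F L \<longleftrightarrow> (\<forall>s t. 0 < s \<longrightarrow> s < t \<longrightarrow> t \<le> 1 \<longrightarrow> F \<inter> {s..<t} = {} \<longrightarrow> L s = L t)"

lemma grid_through_finite_set:
  fixes F :: "real set"
  assumes "finite F"
  obtains N :: nat and a :: "nat \<Rightarrow> real" where "a 0 = 0" "a N = 1" "\<And>i j. i \<le> j \<Longrightarrow> j \<le> N \<Longrightarrow> a i \<le> a j"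
    "\<And>i. i \<in> {1..N} \<Longrightarrow> F \<inter> {a (i - 1)<..<a i} = {}"
proof -
  define G where "G = insert 0 (insert 1 (F \<inter> {0..1}))"
  define xs where "xs = sorted_list_of_set G"
  have fin: "finite G" using assms by (simp add: G_def)
  have set: "set xs = G" and srt: "sorted xs"
    using fin by (auto simp: xs_def)
  have ne: "xs \<noteq> []" using set by (auto simp: G_def)
  have len: "0 < length xs" using ne by simp
  have G01: "x \<in> {0..1}" if "x \<in> G" for x using that by (auto simp: G_def)
  have nth: "xs ! i \<in> {0..1}" if "i < length xs" for i
    using G01 that set nth_mem by blast
  have mono: "xs ! i \<le> xs ! j" if "i \<le> j" "j \<le> length xs - 1" for i j :: nat
    by (rule sorted_nth_mono[OF srt that(1)]) (use that len in linarith)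
  show ?thesis
  proof (rule that[of "\<lambda>i. xs ! i" "length xs - 1"])
    have "0 \<in> set xs" "1 \<in> set xs" using set by (auto simp: G_def)
    then obtain i j where ij: "i < length xs" "xs ! i = 0" "j < length xs" "xs ! j = 1"
      by (metis in_set_conv_nth)
    show "xs ! 0 = 0" using mono[of 0 i] ij nth[of 0] len by force
    show "xs ! (length xs - 1) = 1"
      using mono[of j "length xs - 1"] ij nth[of "length xs - 1"] len by force
    show "xs ! i \<le> xs ! j" if "i \<le> j" "j \<le> length xs - 1" for i j using mono that by blast
    show "F \<inter> {xs ! (i - 1)<..<xs ! i} = {}" if i: "i \<in> {1..length xs - 1}" for i
    proof (rule ccontr)
      assume "F \<inter> {xs ! (i - 1)<..<xs ! i} \<noteq> {}"
      then obtain f where f: "f \<in> F" "xs ! (i - 1) < f" "f < xs ! i" by auto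
      have "xs ! (i - 1) \<in> {0..1}" "xs ! i \<in> {0..1}" using i nth[of i] nth[of "i - 1"] by auto
      then have "f \<in> set xs" using f unfolding set G_def by auto
      then obtain j where j: "j < length xs" "xs ! j = f" by (metis in_set_conv_nth)
      show False
      proof (cases "j \<le> i - 1")
        case True
        moreover have "i - 1 \<le> length xs - 1" using i by auto
        ultimately show False using mono[of j "i - 1"] j f by auto
      next
        case False
        then have "i \<le> j" "j \<le> length xs - 1" using j by auto
        then show False using mono[of i j] j f by auto
      qed
    qed
  qed
qed

text \<open>
  Ranking the cells by a key turns any desired order of the cells into the permutation that an
  interval exchange asks for.
\<close>

lemma rank_permutation:
  fixes key :: "nat \<Rightarrow> nat"
  assumes inj: "inj_on key {1..N}"
  obtains \<pi> where "\<pi> permutes {1..N}"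
    "\<And>i j. i \<in> {1..N} \<Longrightarrow> j \<in> {1..N} \<Longrightarrow> \<pi> i < \<pi> j \<longleftrightarrow> key i < key j"
proof -
  define r where "r i = card {j \<in> {1..N}. key j \<le> key i}" for i
  define \<pi> where "\<pi> i = (if i \<in> {1..N} then r i else i)" for i
  have less: "r i < r j" if "i \<in> {1..N}" "j \<in> {1..N}" "key i < key j" for i j
    unfolding r_def
  proof (rule psubset_card_mono)
    have "j \<in> {k \<in> {1..N}. key k \<le> key j}" "j \<notin> {k \<in> {1..N}. key k \<le> key i}"
      using that by auto
    moreover have "{k \<in> {1..N}. key k \<le> key i} \<subseteq> {k \<in> {1..N}. key k \<le> key j}"
      using that by auto
    ultimately show "{k \<in> {1..N}. key k \<le> key i} \<subset> {k \<in> {1..N}. key k \<le> key j}" by blast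
  qed simp
  have iff: "r i < r j \<longleftrightarrow> key i < key j" if "i \<in> {1..N}" "j \<in> {1..N}" for i j
    using less[of i j] less[of j i] that inj
    by (metis inj_onD linorder_neqE_nat order_less_asym)
  have rinj: "inj_on r {1..N}"
    by (rule inj_onI) (metis iff inj inj_onD linorder_neqE_nat less_irrefl)
  have "r i \<in> {1..N}" if "i \<in> {1..N}" for i
  proof -
    have "card {j \<in> {1..N}. key j \<le> key i} \<le> card {1..N}" by (rule card_mono) auto
    moreover have "card {j \<in> {1..N}. key j \<le> key i} > 0" using that by (auto simp: card_gt_0_iff)
    ultimately show ?thesis by (auto simp: r_def)
  qed
  then have "r ` {1..N} \<subseteq> {1..N}" by blast
  then have "bij_betw r {1..N} {1..N}"
    using rinj endo_inj_surj by (metis bij_betw_def finite_atLeastAtMost)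
  then have "bij_betw \<pi> {1..N} {1..N}"
    by (rule bij_betw_cong[THEN iffD1, rotated]) (auto simp: \<pi>_def)
  then have "\<pi> permutes {1..N}"
    by (rule bij_imp_permutes) (auto simp: \<pi>_def)
  moreover have "\<pi> i < \<pi> j \<longleftrightarrow> key i < key j" if "i \<in> {1..N}" "j \<in> {1..N}" for i j
    using iff[OF that] that by (simp add: \<pi>_def)
  ultimately show ?thesis by (rule that)
qed

text \<open>
  Arrange the cells of a grid adapted to \<open>L\<close> by increasing value of \<open>L\<close>. The cells with value at
  most \<open>l\<close> are then moved onto an initial segment, whose length is the total length of these cells,
  and all other cells are moved beyond it.
\<close>

lemma interval_exchange_sorting_levels:
  fixes L :: "real \<Rightarrow> nat"
  assumes F: "finite F" and step: "step_on F L"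
  obtains \<phi> where "interval_exchange \<phi>"
    "\<And>l t. t \<in> {0<..1} \<Longrightarrow> \<phi> t \<le> measure lborel {s \<in> {0<..1}. L s \<le> l} \<longleftrightarrow> L t \<le> l"
proof -
  obtain N and a :: "nat \<Rightarrow> real" where a0: "a 0 = 0" and aN: "a N = 1"
    and mono: "\<And>i j. i \<le> j \<Longrightarrow> j \<le> N \<Longrightarrow> a i \<le> a j"
    and gap: "\<And>i. i \<in> {1..N} \<Longrightarrow> F \<inter> {a (i - 1)<..<a i} = {}"
    by (rule grid_through_finite_set[OF F]) (rule that; assumption)
  define cell where "cell i = {a (i - 1)<..a i}" for i
  define len where "len i = a i - a (i - 1)" for i
  have len0: "0 \<le> len i" if "i \<in> {1..N}" for i using that mono[of "i - 1" i] by (simp add: len_def)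
  have meas: "measure lborel (cell i) = len i" if "i \<in> {1..N}" for i
    using len0[OF that] by (simp add: cell_def len_def)
  \<comment> \<open>For \<open>t\<close> in \<open>(0,1]\<close>, this is the number of the cell that contains \<open>t\<close>.\<close>
  define idx where "idx t = (LEAST i. t \<le> a i)" for t
  have idx: "idx t = i" if "i \<in> {1..N}" "t \<in> cell i" for i t
    unfolding idx_def
  proof (rule Least_equality)
    show "t \<le> a i" using that by (simp add: cell_def)
    fix j assume "t \<le> a j"
    show "i \<le> j"
    proof (rule ccontr)
      assume "\<not> i \<le> j"
      then have "a j \<le> a (i - 1)" using that by (intro mono) auto
      then show False using that \<open>t \<le> a j\<close> by (auto simp: cell_def)
    qed
  qed
  have idx_in: "idx t \<in> {1..N}" "t \<in> cell (idx t)" if t: "t \<in> {0<..1}" for t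
  proof -
    have le: "t \<le> a (idx t)" unfolding idx_def
      by (rule LeastI[of _ N]) (use t aN in auto)
    have leN: "idx t \<le> N" unfolding idx_def by (rule Least_le) (use t aN in auto)
    have pos: "idx t \<noteq> 0" using le t a0 by (cases "idx t = 0") auto
    have "\<not> t \<le> a (idx t - 1)"
      using pos not_less_Least[of "idx t - 1" "\<lambda>i. t \<le> a i"] unfolding idx_def by auto
    then show "idx t \<in> {1..N}" "t \<in> cell (idx t)" using le leN pos by (auto simp: cell_def)
  qed
  have cell01: "t \<in> {0<..1}" if "i \<in> {1..N}" "t \<in> cell i" for i t
  proof -
    have "a 0 \<le> a (i - 1)" "a i \<le> a N" using that by (auto intro!: mono)
    then show ?thesis using that a0 aN by (auto simp: cell_def)
  qed
  \<comment> \<open>Cells contain their right endpoint, so \<open>L\<close> can be read off there.\<close>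
  define lab where "lab i = L (a i)" for i
  have lab: "L t = lab i" if i: "i \<in> {1..N}" and t: "t \<in> cell i" for i t
  proof (cases "t = a i")
    case False
    have "F \<inter> {t..<a i} = {}" using gap[OF i] t by (auto simp: cell_def)
    then show ?thesis
      using step cell01[OF i t] False t mono[of i N] i aN
      by (auto simp: step_on_def lab_def cell_def)
  qed (simp add: lab_def)
  define S where "S l = {i \<in> {1..N}. lab i \<le> l}" for l
  have level: "measure lborel {s \<in> {0<..1}. L s \<le> l} = (\<Sum>i\<in>S l. len i)" for l
  proof -
    have "{s \<in> {0<..1}. L s \<le> l} = (\<Union>i\<in>S l. cell i)"
    proof (intro subset_antisym subsetI)
      fix s assume s: "s \<in> {s \<in> {0<..1}. L s \<le> l}"
      then have "idx s \<in> S l" using idx_in[of s] lab[of "idx s" s] by (simp add: S_def)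
      then show "s \<in> (\<Union>i\<in>S l. cell i)" using idx_in(2)[of s] s by blast
    next
      fix s assume "s \<in> (\<Union>i\<in>S l. cell i)"
      then obtain i where "i \<in> {1..N}" "lab i \<le> l" "s \<in> cell i" by (auto simp: S_def)
      then show "s \<in> {s \<in> {0<..1}. L s \<le> l}" using lab cell01 by simp
    qed
    also have "measure lborel \<dots> = (\<Sum>i\<in>S l. measure lborel (cell i))"
    proof (rule measure_finite_Union)
      show "disjoint_family_on cell (S l)"
        unfolding disjoint_family_on_def S_def using idx by blast
    qed (use mono in \<open>auto simp: S_def cell_def\<close>)
    also have "\<dots> = (\<Sum>i\<in>S l. len i)" by (rule sum.cong) (auto simp: S_def meas)
    finally show ?thesis .
  qed
  \<comment> \<open>Lexicographic order: first the value of \<open>L\<close>, then, to break ties, the number of the cell.\<close>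
  define key where "key i = lab i * Suc N + i" for i
  have key_less: "key i < key j" if "lab i < lab j" "i \<in> {1..N}" for i j
  proof -
    have "key i < Suc (lab i) * Suc N" using that by (simp add: key_def)
    also have "\<dots> \<le> lab j * Suc N" using that by (intro mult_le_mono1) simp
    also have "\<dots> \<le> key j" by (simp add: key_def)
    finally show ?thesis .
  qed
  have "inj_on key {1..N}"
  proof (rule inj_onI)
    fix i j assume ij: "i \<in> {1..N}" "j \<in> {1..N}" "key i = key j"
    then have "lab i = lab j" using key_less[of i j] key_less[of j i] by force
    then show "i = j" using ij by (simp add: key_def)
  qed
  then obtain \<pi> where perm: "\<pi> permutes {1..N}"
    and \<pi>: "\<And>i j. i \<in> {1..N} \<Longrightarrow> j \<in> {1..N} \<Longrightarrow> \<pi> i < \<pi> j \<longleftrightarrow> key i < key j"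
    by (rule rank_permutation) (rule that; assumption)
  define before where "before i = {j. j \<in> {1..N} \<and> \<pi> j < \<pi> i}" for i
  define \<phi> where "\<phi> t = t - a (idx t - 1) + (\<Sum>j\<in>before (idx t). measure lborel (cell j))" for t
  have before: "finite (before i)" "before i \<subseteq> {1..N}" "i \<notin> before i" for i
    by (auto simp: before_def)
  have sum_before: "(\<Sum>j\<in>before i. measure lborel (cell j)) = (\<Sum>j\<in>before i. len j)" for i
    using before(2)[of i] meas by (intro sum.cong) (auto simp: subset_iff)
  show ?thesis
  proof (rule that)
    show "interval_exchange \<phi>"
      unfolding interval_exchange_def
    proof (intro exI[of _ N] exI[of _ a] exI[of _ \<pi>] conjI ballI a0 aN perm)
      show "a (i - 1) \<le> a i" if "i \<in> {1..N}" for i using that by (intro mono) auto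
      fix i t assume i: "i \<in> {1..N}" and t: "t \<in> {a (i - 1)<..a i}"
      have "idx t = i" using idx i t by (simp add: cell_def)
      then show "\<phi> t = t - a (i - 1)
             + (\<Sum>j | j \<in> {1..N} \<and> \<pi> j < \<pi> i. measure lborel {a (j - 1)<..a j})"
        by (simp add: \<phi>_def before_def cell_def)
    qed
  next
    fix l t assume t: "t \<in> {0<..1::real}"
    define i where "i = idx t"
    have i: "i \<in> {1..N}" and ti: "t \<in> cell i" using idx_in[OF t] by (auto simp: i_def)
    have \<phi>t: "\<phi> t = t - a (i - 1) + (\<Sum>j\<in>before i. len j)"
      by (simp only: \<phi>_def sum_before i_def)
    show "\<phi> t \<le> measure lborel {s \<in> {0<..1}. L s \<le> l} \<longleftrightarrow> L t \<le> l"
    proof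
      assume "L t \<le> l"
      then have li: "lab i \<le> l" using lab[OF i ti] by simp
      have "\<phi> t \<le> len i + (\<Sum>j\<in>before i. len j)"
        using ti by (simp add: \<phi>t len_def cell_def)
      also have "\<dots> = (\<Sum>j\<in>insert i (before i). len j)" using before by simp
      also have "\<dots> \<le> (\<Sum>j\<in>S l. len j)"
      proof (rule sum_mono2)
        have "lab j \<le> l" if "j \<in> before i" for j
        proof (rule ccontr)
          assume "\<not> lab j \<le> l"
          then have "key i < key j" using li i by (intro key_less) auto
          moreover have "j \<in> {1..N}" "\<pi> j < \<pi> i" using that by (auto simp: before_def)
          ultimately show False using \<pi>[of j i] i by simp
        qed
        then show "insert i (before i) \<subseteq> S l" using li i before(2)[of i] by (auto simp: S_def subset_iff)
      qed (auto simp: S_def intro: len0)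
      finally show "\<phi> t \<le> measure lborel {s \<in> {0<..1}. L s \<le> l}" by (simp only: level)
    next
      assume le: "\<phi> t \<le> measure lborel {s \<in> {0<..1}. L s \<le> l}"
      show "L t \<le> l"
      proof (rule ccontr)
        assume "\<not> L t \<le> l"
        then have li: "l < lab i" using lab[OF i ti] by simp
        have "(\<Sum>j\<in>S l. len j) \<le> (\<Sum>j\<in>before i. len j)"
        proof (rule sum_mono2)
          show "S l \<subseteq> before i"
          proof
            fix j assume "j \<in> S l"
            then have j: "j \<in> {1..N}" "lab j < lab i" using li by (auto simp: S_def)
            then show "j \<in> before i" using \<pi>[OF j(1) i] key_less[OF j(2,1)] by (simp add: before_def)
          qed
        qed (use before(1,2)[of i] len0 in \<open>auto simp: subset_iff\<close>)
        also have "\<dots> < \<phi> t" using ti by (simp add: \<phi>t cell_def)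
        finally show False using le by (simp only: level)
      qed
    qed
  qed
qed

section \<open>Finite unions of intervals\<close>

text \<open>
  These are the finite unions of intervals \<open>(x,y]\<close> inside \<open>(0,1]\<close>. Describing them by a finite set of
  possible jumps of membership makes closure under Boolean operations immediate, since the sets of
  jumps are simply united.
\<close>

definition interval_union :: "real set \<Rightarrow> bool" where
  "interval_union X \<longleftrightarrow> X \<subseteq> {0<..1} \<and> X \<in> sets lborel \<and> (\<exists>F. finite F \<and> step_on F (\<lambda>t. t \<in> X))"

lemma step_on_combine:
  assumes "step_on F L" "step_on G M"
  shows "step_on (F \<union> G) (\<lambda>t. h (L t) (M t))"
  using assms unfolding step_on_def Int_Un_distrib2 by (metis Un_empty)

lemma interval_union_Ioc:
  assumes "0 \<le> x" "y \<le> 1"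
  shows "interval_union {x<..y}"
proof -
  have "step_on {x, y} (\<lambda>t. t \<in> {x<..y})" unfolding step_on_def by force
  then show ?thesis using assms unfolding interval_union_def
    by (intro conjI exI[of _ "{x, y}"]) auto
qed

lemma interval_union_Un:
  assumes "interval_union X" "interval_union Y"
  shows "interval_union (X \<union> Y)"
  using assms step_on_combine[of _ "\<lambda>t. t \<in> X" _ "\<lambda>t. t \<in> Y" "(\<or>)"]
  unfolding interval_union_def Un_iff by (meson finite_UnI le_sup_iff sets.Un)

lemma interval_union_Diff:
  assumes "interval_union X" "interval_union Y"
  shows "interval_union (X - Y)"
  using assms step_on_combine[of _ "\<lambda>t. t \<in> X" _ "\<lambda>t. t \<in> Y" "\<lambda>p q. p \<and> \<not> q"]
  unfolding interval_union_def Diff_iff by (meson finite_UnI Diff_subset order_trans sets.Diff)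

lemma interval_union_Int:
  assumes "interval_union X" "interval_union Y"
  shows "interval_union (X \<inter> Y)"
  using interval_union_Diff[OF assms(1) interval_union_Diff[OF assms]] by (simp add: Diff_Diff_Int)

lemma interval_union_UN:
  assumes "finite K" "\<And>k. k \<in> K \<Longrightarrow> interval_union (X k)"
  shows "interval_union (\<Union>k\<in>K. X k)"
  using assms
proof (induction K)
  case empty
  show ?case using interval_union_Ioc[of 1 1] by simp
qed (auto intro: interval_union_Un)

lemma interval_union_fmeasurable:
  assumes "interval_union X"
  shows "X \<in> fmeasurable lborel"
proof (rule fmeasurableI)
  show X: "X \<in> sets lborel" using assms by (simp add: interval_union_def)
  have "emeasure lborel X \<le> emeasure lborel {0<..1::real}"
    using assms by (intro emeasure_mono) (auto simp: interval_union_def)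
  also have "\<dots> < \<infinity>" by simp
  finally show "emeasure lborel X < \<infinity>" .
qed

lemma measure_interval_union_Diff:
  assumes "interval_union X" "interval_union Y" "Y \<subseteq> X"
  shows "measure lborel (X - Y) = measure lborel X - measure lborel Y"
  using assms interval_union_fmeasurable[of X] interval_union_fmeasurable[of Y]
  by (intro measure_Diff fmeasurableD fmeasurableD2[folded infinity_ennreal_def])

lemma measure_interval_union_Un:
  assumes "interval_union X" "interval_union Y" "X \<inter> Y = {}"
  shows "measure lborel (X \<union> Y) = measure lborel X + measure lborel Y"
  using assms interval_union_fmeasurable[of X] interval_union_fmeasurable[of Y]
  by (intro measure_Union fmeasurableD fmeasurableD2[folded infinity_ennreal_def])

lemma measure_interval_union_mono:
  assumes "interval_union X" "interval_union Y" "X \<subseteq> Y"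
  shows "measure lborel X \<le> measure lborel Y"
  using assms interval_union_fmeasurable by (intro measure_mono_fmeasurable) (auto simp: interval_union_def)

text \<open>
  The length of \<open>X \<inter> (0,t]\<close> is a Lipschitz function of \<open>t\<close>, so it takes every intermediate value.
\<close>

lemma interval_union_subset_of_measure:
  assumes X: "interval_union X" and m: "0 \<le> m" "m \<le> measure lborel X"
  obtains Y where "interval_union Y" "Y \<subseteq> X" "measure lborel Y = m"
proof -
  define g where "g t = measure lborel (X \<inter> {0<..t})" for t :: real
  have iu: "interval_union (X \<inter> {0<..t})" if "t \<in> {0..1}" for t
    using that by (intro interval_union_Int X interval_union_Ioc) auto
  have diff: "\<bar>g t - g s\<bar> \<le> t - s" if st: "s \<le> t" "s \<in> {0..1}" "t \<in> {0..1}" for s t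
  proof -
    have "g t - g s = measure lborel (X \<inter> {0<..t} - X \<inter> {0<..s})"
      unfolding g_def using st by (subst measure_interval_union_Diff) (auto intro!: iu)
    also have "X \<inter> {0<..t} - X \<inter> {0<..s} = X \<inter> {s<..t}" using st by auto
    finally have eq: "g t - g s = measure lborel (X \<inter> {s<..t})" .
    have "measure lborel (X \<inter> {s<..t}) \<le> measure lborel {s<..t}"
      using st by (intro measure_interval_union_mono interval_union_Int X interval_union_Ioc) auto
    then show ?thesis using st eq by simp
  qed
  have "1-lipschitz_on {0..1} g"
  proof (rule lipschitz_onI)
    fix s t :: real assume "s \<in> {0..1}" "t \<in> {0..1}"
    then show "dist (g s) (g t) \<le> 1 * dist s t"
      using diff[of s t] diff[of t s] by (cases "s \<le> t") (auto simp: dist_real_def)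
  qed simp
  then have cont: "continuous_on {0..1} g" by (rule lipschitz_on_continuous_on)
  have g0: "g 0 = 0" by (simp add: g_def)
  have "X \<inter> {0<..1} = X" using X by (auto simp: interval_union_def)
  then have "g 1 = measure lborel X" by (simp add: g_def)
  then obtain t where "0 \<le> t" "t \<le> 1" "g t = m"
    using IVT'[of g 0 m 1] cont m g0 by auto
  then show ?thesis using iu[of t] that[of "X \<inter> {0<..t}"] by (auto simp: g_def)
qed

text \<open>
  If \<open>m\<close> is small, place \<open>Y\<close> inside \<open>U\<close>, so that nothing is wasted. Otherwise let \<open>Y\<close> swallow all of
  \<open>U\<close> and spend the rest of the length elsewhere in \<open>X\<close>.
\<close>

lemma greedy_subset:
  assumes X: "interval_union X" and U: "interval_union U" "U \<subseteq> X"
    and m: "0 \<le> m" "m \<le> measure lborel X"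
  obtains Y where "interval_union Y" "Y \<subseteq> X" "measure lborel Y = m"
    "measure lborel (U - Y) \<le> max 0 (measure lborel U - m)"
proof (cases "m \<le> measure lborel U")
  case True
  then obtain Y where Y: "interval_union Y" "Y \<subseteq> U" "measure lborel Y = m"
    using interval_union_subset_of_measure[OF U(1) m(1)] by blast
  then show ?thesis using U measure_interval_union_Diff[OF U(1) Y(1,2)] by (intro that) auto
next
  case False
  have XU: "interval_union (X - U)" using X U by (intro interval_union_Diff)
  have "m - measure lborel U \<le> measure lborel (X - U)"
    using m by (simp add: measure_interval_union_Diff[OF X U])
  then obtain Z where Z: "interval_union Z" "Z \<subseteq> X - U" "measure lborel Z = m - measure lborel U"
    using interval_union_subset_of_measure[OF XU, of "m - measure lborel U"] False by auto
  have "measure lborel (U - (U \<union> Z)) = 0" by (simp add: Diff_eq)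
  moreover have "measure lborel (U \<union> Z) = m"
    using Z by (subst measure_interval_union_Un) (auto intro: U)
  ultimately show ?thesis
    using Z U by (intro that[of "U \<union> Z"]) (auto intro: interval_union_Un)
qed

text \<open>
  Pieces of lengths \<open>m\<^sub>k\<close>, each free to move in a region containing \<open>U\<close>, cover \<open>U\<close> as economically
  as their total length permits, because each of them can be placed greedily on the part of \<open>U\<close> left
  over by the pieces placed before it.
\<close>

lemma greedy_cover:
  fixes m :: "'k \<Rightarrow> real"
  assumes K: "finite K" and U: "interval_union U"
    and X: "\<And>k. k \<in> K \<Longrightarrow> interval_union (X k) \<and> U \<subseteq> X k"
    and m: "\<And>k. k \<in> K \<Longrightarrow> 0 \<le> m k \<and> m k \<le> measure lborel (X k)"
  shows "\<exists>Y. (\<forall>k\<in>K. interval_union (Y k) \<and> Y k \<subseteq> X k \<and> measure lborel (Y k) = m k) \<and>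
    measure lborel (U - (\<Union>k\<in>K. Y k)) \<le> max 0 (measure lborel U - (\<Sum>k\<in>K. m k))"
  using K X m
proof (induction K)
  case empty
  then show ?case by auto
next
  case (insert k K)
  then obtain Y where Y: "\<forall>k\<in>K. interval_union (Y k) \<and> Y k \<subseteq> X k \<and> measure lborel (Y k) = m k"
    and le: "measure lborel (U - (\<Union>k\<in>K. Y k)) \<le> max 0 (measure lborel U - (\<Sum>k\<in>K. m k))"
    by auto
  define V where "V = U - (\<Union>k\<in>K. Y k)"
  have V: "interval_union V"
    unfolding V_def using Y insert.hyps by (intro interval_union_Diff U interval_union_UN) auto
  have "V \<subseteq> X k" using insert.prems by (auto simp: V_def)
  then obtain Z where Z: "interval_union Z" "Z \<subseteq> X k" "measure lborel Z = m k"
    "measure lborel (V - Z) \<le> max 0 (measure lborel V - m k)"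
    using greedy_subset[of "X k" V "m k"] V insert.prems by auto
  have "U - (\<Union>j\<in>insert k K. (Y(k := Z)) j) = V - Z"
    using insert.hyps by (auto simp: V_def)
  moreover have "measure lborel (V - Z) \<le> max 0 (measure lborel U - (\<Sum>k\<in>insert k K. m k))"
  proof -
    have "(\<Sum>k\<in>insert k K. m k) = m k + (\<Sum>k\<in>K. m k)" using insert.hyps by simp
    then show ?thesis using Z(4) le insert.prems(2)[of k] unfolding V_def by auto
  qed
  ultimately show ?case using Y Z insert.hyps by (intro exI[of _ "Y(k := Z)"]) auto
qed

section \<open>Shuffles of min with prescribed behaviour at two points\<close>

text \<open>
  Sort the three blocks \<open>A\<close>, \<open>B - A\<close> and the complement of \<open>B\<close> in this order.
\<close>

lemma interval_exchange_of_chain: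
  assumes A: "interval_union A" and B: "interval_union B" and sub: "A \<subseteq> B"
  obtains \<phi> where "interval_exchange \<phi>"
    "\<And>t. t \<in> {0<..1} \<Longrightarrow> \<phi> t \<le> measure lborel A \<longleftrightarrow> t \<in> A"
    "\<And>t. t \<in> {0<..1} \<Longrightarrow> \<phi> t \<le> measure lborel B \<longleftrightarrow> t \<in> B"
proof -
  obtain F G where F: "finite F" "step_on F (\<lambda>t. t \<in> A)" and G: "finite G" "step_on G (\<lambda>t. t \<in> B)"
    using A B unfolding interval_union_def by blast
  define L :: "real \<Rightarrow> nat" where "L t = (if t \<in> A then 0 else if t \<in> B then 1 else 2)" for t
  have "step_on (F \<union> G) L"
    using step_on_combine[OF F(2) G(2), of "\<lambda>p q. if p then 0 else if q then 1 else 2 :: nat"]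
    by (simp add: L_def[abs_def])
  then obtain \<phi> where \<phi>: "interval_exchange \<phi>"
    "\<And>l t. t \<in> {0<..1} \<Longrightarrow> \<phi> t \<le> measure lborel {s \<in> {0<..1}. L s \<le> l} \<longleftrightarrow> L t \<le> l"
    using interval_exchange_sorting_levels[of "F \<union> G" L] F G by blast
  have "{s \<in> {0<..1}. L s \<le> 0} = A" using A by (auto simp: L_def interval_union_def)
  moreover have "{s \<in> {0<..1}. L s \<le> 1} = B" using B sub by (auto simp: L_def interval_union_def)
  ultimately show ?thesis
    using \<phi>(2)[of _ 0] \<phi>(2)[of _ 1] sub by (intro that[OF \<phi>(1)]) (auto simp: L_def split: if_splits)
qed

lemma interval_exchange_of_comparable:
  assumes "interval_union A" "interval_union B" "A \<subseteq> B \<or> B \<subseteq> A"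
  shows "\<exists>\<phi>. interval_exchange \<phi> \<and>
    (\<forall>t\<in>{0<..1}. (\<phi> t \<le> measure lborel A \<longleftrightarrow> t \<in> A) \<and> (\<phi> t \<le> measure lborel B \<longleftrightarrow> t \<in> B))"
  using assms(3)
proof
  assume "A \<subseteq> B"
  from interval_exchange_of_chain[OF assms(1,2) this] show ?thesis by metis
next
  assume "B \<subseteq> A"
  from interval_exchange_of_chain[OF assms(2,1) this] show ?thesis by metis
qed

lemma shuffle_of_min_of_comparable:
  fixes u v :: "real ^ 'n::finite"
  assumes A: "\<And>k. interval_union (A k) \<and> measure lborel (A k) = u $ k"
    and B: "\<And>k. interval_union (B k) \<and> measure lborel (B k) = v $ k"
    and comp: "\<And>k. A k \<subseteq> B k \<or> B k \<subseteq> A k"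
  obtains C where "shuffle_of_min C"
    "C u = measure lborel (\<Inter>k. A k)" "C v = measure lborel (\<Inter>k. B k)"
proof -
  have ex: "\<forall>k. \<exists>\<phi>. interval_exchange \<phi> \<and>
      (\<forall>t\<in>{0<..1}. (\<phi> t \<le> u $ k \<longleftrightarrow> t \<in> A k) \<and> (\<phi> t \<le> v $ k \<longleftrightarrow> t \<in> B k))"
  proof
    fix k
    from interval_exchange_of_comparable[of "A k" "B k"] A[of k] B[of k] comp[of k]
    show "\<exists>\<phi>. interval_exchange \<phi> \<and>
      (\<forall>t\<in>{0<..1}. (\<phi> t \<le> u $ k \<longleftrightarrow> t \<in> A k) \<and> (\<phi> t \<le> v $ k \<longleftrightarrow> t \<in> B k))"
      by simp
  qed
  from choice[OF ex] obtain \<phi> where all: "\<forall>k. interval_exchange (\<phi> k) \<and>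
      (\<forall>t\<in>{0<..1}. (\<phi> k t \<le> u $ k \<longleftrightarrow> t \<in> A k) \<and> (\<phi> k t \<le> v $ k \<longleftrightarrow> t \<in> B k))" ..
  then have \<phi>: "\<And>k. interval_exchange (\<phi> k)"
    "\<And>k t. t \<in> {0<..1} \<Longrightarrow> (\<phi> k t \<le> u $ k \<longleftrightarrow> t \<in> A k) \<and> (\<phi> k t \<le> v $ k \<longleftrightarrow> t \<in> B k)"
    by simp_all
  define C where "C w = measure lborel {t \<in> {0<..1}. \<forall>k. \<phi> k t \<le> w $ k}" for w :: "real ^ 'n"
  have sub: "A k \<subseteq> {0<..1}" "B k \<subseteq> {0<..1}" for k
    using A[of k] B[of k] by (auto simp: interval_union_def)
  have "{t \<in> {0<..1}. \<forall>k. \<phi> k t \<le> u $ k} = {t \<in> {0<..1}. \<forall>k. t \<in> A k}"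
    "{t \<in> {0<..1}. \<forall>k. \<phi> k t \<le> v $ k} = {t \<in> {0<..1}. \<forall>k. t \<in> B k}"
    using \<phi>(2) by auto
  moreover have "{t \<in> {0<..1}. \<forall>k. t \<in> A k} = (\<Inter>k. A k)"
    "{t \<in> {0<..1}. \<forall>k. t \<in> B k} = (\<Inter>k. B k)"
    using sub by blast+
  ultimately show ?thesis
    using \<phi>(1) by (intro that[of C]) (auto simp: C_def shuffle_of_min_def)
qed

text \<open>
  The complements of the sets \<open>A k\<close> and \<open>B k\<close> share a part \<open>E k\<close> of length
  \<open>1 - max (u $ k) (v $ k)\<close>, which is confined to \<open>R = (q,1]\<close>. If \<open>u $ k < v $ k\<close>, then \<open>A k\<close> misses a
  further part \<open>D k\<close>. Otherwise \<open>B k\<close> misses a further part \<open>G k\<close>, again confined to \<open>R\<close>. Let \<open>T\<close>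
  be the total length of the \<open>E k\<close> and \<open>S\<close> that of the \<open>D k\<close>. After the greedy placement of
  the \<open>E k\<close> in \<open>R\<close>, a set of length at most \<open>max q (1 - T)\<close> is uncovered in \<open>(0,1]\<close>. After that of
  the \<open>D k\<close>, at most the maximum of \<open>0\<close>, \<open>q - S\<close> and \<open>1 - T - S\<close> is left. None of the three
  exceeds \<open>p\<close>, which is what the hypotheses on \<open>p\<close> and \<open>q\<close> say, as \<open>S + T\<close> is the sum of
  the \<open>1 - u $ k\<close>.
\<close>

lemma shuffle_of_min_between:
  fixes u v :: "real ^ 'n::finite"
  assumes u: "u \<in> unit_cube" and v: "v \<in> unit_cube"
    and p: "0 \<le> p" "1 - p \<le> (\<Sum>k\<in>UNIV. 1 - u $ k)"
    and q: "0 \<le> q" "\<And>k. q \<le> v $ k"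
    and pq: "q - p \<le> (\<Sum>k\<in>UNIV. max 0 (v $ k - u $ k))"
  obtains C where "shuffle_of_min C" "C u \<le> p" "q \<le> C v"
proof -
  have u01: "0 \<le> u $ k" "u $ k \<le> 1" and v01: "0 \<le> v $ k" "v $ k \<le> 1" for k
    using u v by (auto simp: unit_cube_def)
  have q1: "q \<le> 1" using q(2)[of undefined] v01(2)[of undefined] by linarith
  define R where "R = {q<..1}"
  have R: "interval_union R" "measure lborel R = 1 - q"
    using q q1 by (auto simp: R_def intro: interval_union_Ioc)
  define I :: "real set" where "I = {0<..1}"
  have I: "interval_union I" "measure lborel I = 1" by (auto simp: I_def intro: interval_union_Ioc)
  have RI: "R \<subseteq> I" using q by (auto simp: R_def I_def)
  define e where "e k = 1 - max (u $ k) (v $ k)" for k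
  have e: "0 \<le> e k" "e k \<le> 1 - q" for k
    using u01[of k] v01[of k] q(2)[of k] by (auto simp: e_def)
  have "\<exists>E. (\<forall>k\<in>UNIV. interval_union (E k) \<and> E k \<subseteq> R \<and> measure lborel (E k) = e k) \<and>
    measure lborel (R - (\<Union>k\<in>UNIV. E k)) \<le> max 0 (measure lborel R - (\<Sum>k\<in>UNIV. e k))"
    using R e by (intro greedy_cover) auto
  then obtain E where "\<forall>k. interval_union (E k) \<and> E k \<subseteq> R \<and> measure lborel (E k) = e k"
    and Ecov: "measure lborel (R - (\<Union>k. E k)) \<le> max 0 (1 - q - (\<Sum>k\<in>UNIV. e k))"
    unfolding R(2) by auto
  then have E: "interval_union (E k)" "E k \<subseteq> R" "measure lborel (E k) = e k" for k
    by simp_all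
  define U where "U = I - (\<Union>k. E k)"
  have EU: "interval_union (\<Union>k. E k)" by (intro interval_union_UN E) auto
  have ER: "(\<Union>k. E k) \<subseteq> R" using E(2) by blast
  have U: "interval_union U" unfolding U_def by (intro interval_union_Diff I EU)
  have "measure lborel U = q + measure lborel (R - (\<Union>k. E k))"
    unfolding U_def using RI ER
    by (simp add: measure_interval_union_Diff[OF I(1) EU] measure_interval_union_Diff[OF R(1) EU] R I)
  with Ecov have Ule: "measure lborel U \<le> max q (1 - (\<Sum>k\<in>UNIV. e k))" by linarith
  have IE: "interval_union (I - E k)" "measure lborel (I - E k) = max (u $ k) (v $ k)" for k
    using measure_interval_union_Diff[OF I(1) E(1)[of k]] E(1,3)[of k] order_trans[OF E(2)[of k] RI]
    by (auto simp: e_def I intro!: interval_union_Diff I)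
  define K where "K = {k. u $ k < v $ k}"
  \<comment> \<open>\<open>D k\<close> must avoid \<open>E k\<close>, but that leaves it all of the uncovered set \<open>U\<close>.\<close>
  have "\<exists>D. (\<forall>k\<in>K. interval_union (D k) \<and> D k \<subseteq> I - E k \<and> measure lborel (D k) = v $ k - u $ k) \<and>
    measure lborel (U - (\<Union>k\<in>K. D k)) \<le> max 0 (measure lborel U - (\<Sum>k\<in>K. v $ k - u $ k))"
    using U IE u01 by (intro greedy_cover) (auto simp: K_def U_def)
  then obtain D where
      "\<forall>k\<in>K. interval_union (D k) \<and> D k \<subseteq> I - E k \<and> measure lborel (D k) = v $ k - u $ k"
    and Dcov: "measure lborel (U - (\<Union>k\<in>K. D k)) \<le> max 0 (measure lborel U - (\<Sum>k\<in>K. v $ k - u $ k))"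
    by blast
  then have D: "interval_union (D k)" "D k \<subseteq> I - E k" "measure lborel (D k) = v $ k - u $ k"
    if "k \<in> K" for k
    using that by simp_all
  have SK: "(\<Sum>k\<in>K. v $ k - u $ k) = (\<Sum>k\<in>UNIV. max 0 (v $ k - u $ k))"
    by (rule sum.mono_neutral_cong_left) (auto simp: K_def)
  have "(\<Sum>k\<in>UNIV. e k) + (\<Sum>k\<in>UNIV. max 0 (v $ k - u $ k)) = (\<Sum>k\<in>UNIV. 1 - u $ k)"
    unfolding sum.distrib[symmetric] by (rule sum.cong) (auto simp: e_def)
  with Dcov Ule p pq SK have uncovered: "measure lborel (U - (\<Union>k\<in>K. D k)) \<le> p" by linarith
  have RE: "interval_union (R - E k)" "measure lborel (R - E k) = 1 - q - e k" for k
    using measure_interval_union_Diff[OF R(1) E(1)[of k]] E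
    by (auto simp: R intro!: interval_union_Diff R)
  have "\<forall>k. \<exists>G. k \<notin> K \<longrightarrow> interval_union G \<and> G \<subseteq> R - E k \<and> measure lborel G = u $ k - v $ k"
  proof (intro allI)
    fix k
    have "\<exists>G. interval_union G \<and> G \<subseteq> R - E k \<and> measure lborel G = u $ k - v $ k" if "k \<notin> K"
    proof -
      have "0 \<le> u $ k - v $ k" "u $ k - v $ k \<le> measure lborel (R - E k)"
        using that q(2)[of k] by (auto simp: RE(2) K_def e_def)
      from interval_union_subset_of_measure[OF RE(1) this] show ?thesis by blast
    qed
    then show "\<exists>G. k \<notin> K \<longrightarrow> interval_union G \<and> G \<subseteq> R - E k \<and> measure lborel G = u $ k - v $ k"
      by blast
  qed
  from choice[OF this] obtain G where
    "\<forall>k. k \<notin> K \<longrightarrow> interval_union (G k) \<and> G k \<subseteq> R - E k \<and> measure lborel (G k) = u $ k - v $ k" ..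
  then have G: "interval_union (G k)" "G k \<subseteq> R - E k" "measure lborel (G k) = u $ k - v $ k"
    if "k \<notin> K" for k
    using that by simp_all
  define A where "A k = (if k \<in> K then I - E k - D k else I - E k)" for k
  define B where "B k = (if k \<in> K then I - E k else I - E k - G k)" for k
  have A: "interval_union (A k) \<and> measure lborel (A k) = u $ k" for k
  proof (cases "k \<in> K")
    case True
    then show ?thesis
      using measure_interval_union_Diff[OF IE(1) D(1,2)[OF True]]
        interval_union_Diff[OF IE(1) D(1)[OF True]] D(3)[OF True] IE(2)[of k]
      by (simp add: A_def K_def)
  qed (use IE in \<open>auto simp: A_def K_def\<close>)
  have B: "interval_union (B k) \<and> measure lborel (B k) = v $ k" for k
  proof (cases "k \<in> K")
    case False
    then have "G k \<subseteq> I - E k" using G(2) RI by blast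
    then show ?thesis
      using False measure_interval_union_Diff[OF IE(1) G(1)[OF False]]
        interval_union_Diff[OF IE(1) G(1)[OF False]] G(3)[OF False] IE(2)[of k]
      by (simp add: B_def K_def)
  qed (use IE in \<open>auto simp: B_def K_def\<close>)
  obtain C where C: "shuffle_of_min C"
    "C u = measure lborel (\<Inter>k. A k)" "C v = measure lborel (\<Inter>k. B k)"
  proof (rule shuffle_of_min_of_comparable[OF A B])
    show "A k \<subseteq> B k \<or> B k \<subseteq> A k" for k by (auto simp: A_def B_def)
  qed (rule that; assumption)
  have "t \<in> A k \<longleftrightarrow> t \<in> I \<and> t \<notin> E k \<and> (k \<in> K \<longrightarrow> t \<notin> D k)" for t k
    by (auto simp: A_def)
  then have "(\<Inter>k. A k) = U - (\<Union>k\<in>K. D k)"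
    unfolding set_eq_iff U_def by simp blast
  then have "C u \<le> p" using C uncovered by simp
  moreover have "q \<le> C v"
  proof -
    have "{0<..q} \<subseteq> B k" for k
    proof -
      have "{0<..q} \<subseteq> I - R" using q1 by (auto simp: I_def R_def)
      moreover have "I - R \<subseteq> B k" using E(2)[of k] G(2)[of k] by (cases "k \<in> K") (auto simp: B_def)
      ultimately show ?thesis by (rule order_trans)
    qed
    then have sub: "{0<..q} \<subseteq> (\<Inter>k. B k)" by blast
    have "(\<Inter>k. B k) \<in> sets lborel"
      using B by (intro sets.finite_INT) (auto simp: interval_union_def)
    moreover have "B undefined \<subseteq> I" by (auto simp: B_def)
    then have "(\<Inter>k. B k) \<subseteq> I" by blast
    ultimately have "(\<Inter>k. B k) \<in> fmeasurable lborel"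
      using fmeasurableI2[OF interval_union_fmeasurable[OF I(1)]] by blast
    then have "measure lborel {0<..q} \<le> measure lborel (\<Inter>k. B k)"
      by (intro measure_mono_fmeasurable sub) auto
    then show ?thesis using C q by simp
  qed
  ultimately show ?thesis by (rule that[OF C(1)])
qed

section \<open>Quasi-copulas\<close>

text \<open>
  Monotonicity in each variable gives monotonicity on the cube by raising one coordinate at a time.
\<close>

lemma quasi_copula_mono:
  fixes Q :: "real ^ 'n::finite \<Rightarrow> real"
  assumes Q: "quasi_copula Q" and x: "x \<in> unit_cube" and y: "y \<in> unit_cube" and le: "\<And>k. x $ k \<le> y $ k"
  shows "Q x \<le> Q y"
proof -
  have "Q x \<le> Q (\<chi> i. if i \<in> S then y $ i else x $ i)" if "finite S" for S
    using that
  proof (induction S)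
    case empty
    then show ?case by simp
  next
    case (insert k S)
    define z where "z = (\<chi> i. if i \<in> S then y $ i else x $ i)"
    have z: "z \<in> unit_cube" using x y by (auto simp: z_def unit_cube_def)
    have "y $ k \<in> {z $ k..1}" using insert.hyps le y by (auto simp: z_def unit_cube_def)
    then have "Q z \<le> Q (\<chi> i. if i = k then y $ k else z $ i)"
      using Q z unfolding quasi_copula_def by blast
    also have "(\<chi> i. if i = k then y $ k else z $ i) = (\<chi> i. if i \<in> insert k S then y $ i else x $ i)"
      by (auto simp: z_def vec_eq_iff)
    finally show ?case using insert.IH unfolding z_def by linarith
  qed
  from this[of UNIV] show ?thesis by simp
qed

text \<open>
  The lower and upper Frechet-Hoeffding bounds supply the hypotheses on \<open>Q u\<close> and \<open>Q v\<close>
  separately. The Lipschitz condition, applied between \<open>u\<close> and the join of \<open>u\<close> and \<open>v\<close>, bounds the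
  growth from \<open>u\<close> to \<open>v\<close> by the coordinates that increase.
\<close>

lemma shuffle_of_min_interpolates:
  fixes Q :: "real ^ 'n::finite \<Rightarrow> real"
  assumes Q: "quasi_copula Q" and u: "u \<in> unit_cube" and v: "v \<in> unit_cube"
  obtains C where "shuffle_of_min C" "C u \<le> Q u" "Q v \<le> C v"
proof (rule shuffle_of_min_between[OF u v, of "Q u" "Q v"])
  have range: "\<And>w. w \<in> unit_cube \<Longrightarrow> Q w \<in> {0..1}"
    and marg: "\<And>j t. t \<in> {0..1} \<Longrightarrow> Q (\<chi> i. if i = j then t else 1) = t"
    and lip: "\<And>x y. x \<in> unit_cube \<Longrightarrow> y \<in> unit_cube \<Longrightarrow> \<bar>Q y - Q x\<bar> \<le> (\<Sum>j\<in>UNIV. \<bar>y $ j - x $ j\<bar>)"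
    using Q by (auto simp: quasi_copula_def)
  have u01: "u $ k \<in> {0..1}" and v01: "v $ k \<in> {0..1}" for k
    using u v by (auto simp: unit_cube_def)
  show "0 \<le> Q u" "0 \<le> Q v" using range u v by auto
  have one: "Q 1 = 1" using marg[of 1 undefined] by (simp add: one_vec_def)
  have "\<bar>Q 1 - Q u\<bar> \<le> (\<Sum>k\<in>UNIV. \<bar>1 $ k - u $ k\<bar>)"
    by (rule lip) (use u in \<open>auto simp: unit_cube_def\<close>)
  also have "\<dots> = (\<Sum>k\<in>UNIV. 1 - u $ k)"
    by (rule sum.cong) (use u01 in auto)
  finally show "1 - Q u \<le> (\<Sum>k\<in>UNIV. 1 - u $ k)" using one by linarith
  show "Q v \<le> v $ k" for k
  proof -
    have "Q v \<le> Q (\<chi> i. if i = k then v $ k else 1)"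
      by (rule quasi_copula_mono[OF Q v]) (use v01 in \<open>auto simp: unit_cube_def\<close>)
    then show ?thesis using marg v01 by simp
  qed
  define w where "w = (\<chi> k. max (u $ k) (v $ k))"
  have w: "w \<in> unit_cube" using u01 v01 by (auto simp: w_def unit_cube_def max_def)
  have "Q v \<le> Q w" by (rule quasi_copula_mono[OF Q v w]) (simp add: w_def)
  moreover have "\<bar>Q w - Q u\<bar> \<le> (\<Sum>k\<in>UNIV. \<bar>w $ k - u $ k\<bar>)" by (rule lip[OF u w])
  moreover have "(\<Sum>k\<in>UNIV. \<bar>w $ k - u $ k\<bar>) = (\<Sum>k\<in>UNIV. max 0 (v $ k - u $ k))"
    by (rule sum.cong) (auto simp: w_def)
  ultimately show "Q v - Q u \<le> (\<Sum>k\<in>UNIV. max 0 (v $ k - u $ k))" by linarith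
qed (use that in blast)

text \<open>
  The suprema and infima of reals below are meaningful only for bounded families, which this
  provides.
\<close>

lemma shuffle_of_min_range:
  assumes C: "shuffle_of_min C" and w: "w \<in> unit_cube"
  shows "0 \<le> C w" "C w \<le> 1"
proof -
  obtain \<phi> where "\<forall>u\<in>unit_cube. C u = measure lborel {t \<in> {0<..1::real}. \<forall>k. \<phi> k t \<le> u $ k}"
    using C unfolding shuffle_of_min_def by (elim exE conjE)
  then have "C w = measure lborel {t \<in> {0<..1}. \<forall>k. \<phi> k t \<le> w $ k}" (is "_ = measure lborel ?T")
    using w by (rule bspec)
  moreover have "measure lborel ?T \<le> measure lborel {0<..1::real}"
  proof (cases "?T \<in> sets lborel")
    case True
    then show ?thesis
      by (intro measure_mono_fmeasurable interval_union_fmeasurable interval_union_Ioc) auto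
  qed (simp add: measure_notin_sets)
  ultimately show "0 \<le> C w" "C w \<le> 1" by auto
qed

section \<open>From two-point interpolation to lattice representations\<close>

text \<open>
  The set \<open>lower u\<close> contains, for every \<open>w\<close>, a function that is at least \<open>f w\<close> at \<open>w\<close>, and all its
  members are at most \<open>f u\<close> at \<open>u\<close>. So its supremum is a majorant of \<open>f\<close> that touches \<open>f\<close> at \<open>u\<close>.
  Dually, the infimum of \<open>upper v\<close> is a minorant of \<open>f\<close> that touches \<open>f\<close> at \<open>v\<close>.
\<close>

lemma inf_sup_and_sup_inf_of_two_point_interpolation:
  fixes f :: "'a \<Rightarrow> real" and \<C> :: "('a \<Rightarrow> real) set"
  assumes ne: "X \<noteq> {}"
    and range: "\<And>C w. C \<in> \<C> \<Longrightarrow> w \<in> X \<Longrightarrow> 0 \<le> C w \<and> C w \<le> 1"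
    and interp: "\<And>u v. u \<in> X \<Longrightarrow> v \<in> X \<Longrightarrow> \<exists>C\<in>\<C>. C u \<le> f u \<and> f v \<le> C v"
  shows "(\<exists>\<M>. \<M> \<noteq> {} \<and> (\<forall>S\<in>\<M>. S \<noteq> {} \<and> S \<subseteq> \<C>) \<and> (\<forall>w\<in>X. f w = (INF S\<in>\<M>. SUP C\<in>S. C w)))"
    and "(\<exists>\<M>. \<M> \<noteq> {} \<and> (\<forall>S\<in>\<M>. S \<noteq> {} \<and> S \<subseteq> \<C>) \<and> (\<forall>w\<in>X. f w = (SUP S\<in>\<M>. INF C\<in>S. C w)))"
proof -
  have above: "bdd_above ((\<lambda>C. C w) ` S)" and below: "bdd_below ((\<lambda>C. C w) ` S)"
    if "S \<subseteq> \<C>" "w \<in> X" for S w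
    using that range by (auto intro!: bdd_aboveI2[of _ _ 1] bdd_belowI2[of _ 0])
  define lower where "lower u = {C \<in> \<C>. C u \<le> f u}" for u
  define upper where "upper v = {C \<in> \<C>. f v \<le> C v}" for v
  have sub: "lower u \<subseteq> \<C>" "upper u \<subseteq> \<C>" for u by (auto simp: lower_def upper_def)
  have nonempty: "lower u \<noteq> {}" "upper u \<noteq> {}" if "u \<in> X" for u
    using interp[OF that that] by (auto simp: lower_def upper_def)
  show "(\<exists>\<M>. \<M> \<noteq> {} \<and> (\<forall>S\<in>\<M>. S \<noteq> {} \<and> S \<subseteq> \<C>) \<and> (\<forall>w\<in>X. f w = (INF S\<in>\<M>. SUP C\<in>S. C w)))"
  proof (intro exI[of _ "lower ` X"] conjI ballI)
    fix w assume w: "w \<in> X"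
    have ge: "f w \<le> (SUP C\<in>lower u. C w)" if u: "u \<in> X" for u
    proof -
      obtain C where C: "C \<in> \<C>" "C u \<le> f u" "f w \<le> C w" using interp[OF u w] by blast
      then show ?thesis
        using above[OF sub(1)[of u] w] by (intro cSUP_upper2[of _ _ C]) (auto simp: lower_def)
    qed
    have "(SUP C\<in>lower w. C w) \<le> f w"
      using nonempty[OF w] by (intro cSUP_least) (auto simp: lower_def)
    moreover have "(INF S\<in>lower ` X. SUP C\<in>S. C w) \<le> (SUP C\<in>lower w. C w)"
      using w ge by (intro cINF_lower) (auto intro!: bdd_belowI2[of _ "f w"])
    moreover have "f w \<le> (INF S\<in>lower ` X. SUP C\<in>S. C w)"
      using ne ge by (intro cINF_greatest) auto
    ultimately show "f w = (INF S\<in>lower ` X. SUP C\<in>S. C w)" by linarith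
  qed (use ne sub nonempty in auto)
  show "(\<exists>\<M>. \<M> \<noteq> {} \<and> (\<forall>S\<in>\<M>. S \<noteq> {} \<and> S \<subseteq> \<C>) \<and> (\<forall>w\<in>X. f w = (SUP S\<in>\<M>. INF C\<in>S. C w)))"
  proof (intro exI[of _ "upper ` X"] conjI ballI)
    fix w assume w: "w \<in> X"
    have le: "(INF C\<in>upper v. C w) \<le> f w" if v: "v \<in> X" for v
    proof -
      obtain C where C: "C \<in> \<C>" "C w \<le> f w" "f v \<le> C v" using interp[OF w v] by blast
      then show ?thesis
        using below[OF sub(2)[of v] w] by (intro cINF_lower2[of _ _ C]) (auto simp: upper_def)
    qed
    have "f w \<le> (INF C\<in>upper w. C w)"
      using nonempty[OF w] by (intro cINF_greatest) (auto simp: upper_def)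
    moreover have "(INF C\<in>upper w. C w) \<le> (SUP S\<in>upper ` X. INF C\<in>S. C w)"
      using w le by (intro cSUP_upper) (auto intro!: bdd_aboveI2[of _ _ "f w"])
    moreover have "(SUP S\<in>upper ` X. INF C\<in>S. C w) \<le> f w"
      using ne le by (intro cSUP_least) auto
    ultimately show "f w = (SUP S\<in>upper ` X. INF C\<in>S. C w)" by linarith
  qed (use ne sub nonempty in auto)
qed

theorem theorem5:
  fixes Q :: "real ^ 'n::finite \<Rightarrow> real"
  assumes "CARD('n) \<ge> 2"
    and "quasi_copula Q"
  shows "(\<exists>\<M> :: (real ^ 'n \<Rightarrow> real) set set.
            \<M> \<noteq> {} \<and> (\<forall>S\<in>\<M>. S \<noteq> {} \<and> (\<forall>C\<in>S. shuffle_of_min C)) \<and>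
            (\<forall>u\<in>unit_cube. Q u = (INF S\<in>\<M>. SUP C\<in>S. C u))) \<and>
         (\<exists>\<M>' :: (real ^ 'n \<Rightarrow> real) set set.
            \<M>' \<noteq> {} \<and> (\<forall>S\<in>\<M>'. S \<noteq> {} \<and> (\<forall>C\<in>S. shuffle_of_min C)) \<and>
            (\<forall>u\<in>unit_cube. Q u = (SUP S\<in>\<M>'. INF C\<in>S. C u)))"
proof -
  have "(1 :: real ^ 'n) \<in> unit_cube" by (simp add: unit_cube_def)
  then have ne: "(unit_cube :: (real ^ 'n) set) \<noteq> {}" by blast
  have interp: "\<exists>C\<in>{C. shuffle_of_min C}. C u \<le> Q u \<and> Q v \<le> C v"
    if "u \<in> unit_cube" "v \<in> unit_cube" for u v
    using shuffle_of_min_interpolates[OF assms(2) that] by blast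
  have sub: "S \<subseteq> {C. shuffle_of_min C} \<longleftrightarrow> (\<forall>C\<in>S. shuffle_of_min C)"
    for S :: "(real ^ 'n \<Rightarrow> real) set"
    by blast
  have range: "0 \<le> C w \<and> C w \<le> 1" if "C \<in> {C. shuffle_of_min C}" "w \<in> unit_cube"
    for C and w :: "real ^ 'n"
    using shuffle_of_min_range[of C w] that by simp
  note two = inf_sup_and_sup_inf_of_two_point_interpolation
    [where X = unit_cube and \<C> = "{C. shuffle_of_min C}" and f = Q]
  show ?thesis
    by (rule conjI[OF two, unfolded sub]) (fact ne range interp)+
qed

end
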